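(* Let $N\in\{2,3\}$ and let $g\in L^1([0,1])$ satisfy $g\ge0$ almost everywhere and $\operatorname{ess\,sup} g>0$. Then there exists $\lambda_1>0$ such that for every $\lambda>\lambda_1$ the singular boundary value problem $$-w''+(N-2)w'+(N-1)w=\frac{N-1}{2}e^{-t}w^2+\lambda e^{(N-3)t}\int_0^{e^{-t}}g(s)\,ds\quad(t>0),\qquad w(0)=0,\quad\lim_{t\to\infty}w(t)=0,$$ has no weak solutions $w\in H^1_\mu$.
   Context: For $v:[0,\infty)\to\mathbb{R}$ put $\|v\|_\mu=\left(\int_0^\infty[(v')^2+v^2]e^{(2-N)t}\,dt\right)^{1/2}$. $H^1_\mu$ is the completion with respect to $\|\cdot\|_\mu$ of the smooth functions compactly supported in $(0,\infty)$ (so its elements vanish at $t=0$). A weak solution is a $w\in H^1_\mu$ satisfying the equation in the sense of distributions on $(0,\infty)$ together with the boundary conditions. *)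

theory Defs
  imports "HOL-Probability.Essential_Supremum"
begin

definition test_function :: "(real \<Rightarrow> real) \<Rightarrow> bool" where
  "test_function \<phi> \<longleftrightarrow>
     (\<forall>k t. (deriv ^^ k) \<phi> differentiable (at t)) \<and>
     compact (closure {t. \<phi> t \<noteq> 0}) \<and>
     closure {t. \<phi> t \<noteq> 0} \<subseteq> {0<..}"

definition mu_norm :: "nat \<Rightarrow> (real \<Rightarrow> real) \<Rightarrow> real" where
  "mu_norm N v =
     sqrt (LINT t:{0..}|lebesgue. ((deriv v t)\<^sup>2 + (v t)\<^sup>2) * exp ((2 - real N) * t))"

(* The completion of the test functions under mu_norm, realised as a space of functions: an
   element is given by a mu_norm-Cauchy sequence of test functions and is identified with the
   limit w of that sequence in the weighted L2 space on [0, infinity). This identification is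
   injective, because the derivatives also converge in the weighted L2 space, necessarily to
   the weak derivative of w. Membership depends only on the class of w
   modulo equality almost everywhere on [0, infinity). *)
definition H1_mu :: "nat \<Rightarrow> (real \<Rightarrow> real) set" where
  "H1_mu N = {w.
     w \<in> borel_measurable (lebesgue_on {0..}) \<and>
     set_integrable lebesgue {0..} (\<lambda>t. (w t)\<^sup>2 * exp ((2 - real N) * t)) \<and>
     (\<exists>\<phi> :: nat \<Rightarrow> real \<Rightarrow> real.
        (\<forall>n. test_function (\<phi> n)) \<and>
        (\<forall>e>0. \<exists>M. \<forall>m\<ge>M. \<forall>n\<ge>M. mu_norm N (\<lambda>t. \<phi> m t - \<phi> n t) < e) \<and>
        (\<lambda>n. LINT t:{0..}|lebesgue. (\<phi> n t - w t)\<^sup>2 * exp ((2 - real N) * t))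
          \<longlonglongrightarrow> 0)}"

definition bvp_rhs :: "nat \<Rightarrow> (real \<Rightarrow> real) \<Rightarrow> real \<Rightarrow> (real \<Rightarrow> real) \<Rightarrow> real \<Rightarrow> real" where
  "bvp_rhs N g lam w t =
     (real N - 1) / 2 * exp (- t) * (w t)\<^sup>2
     + lam * exp ((real N - 3) * t) * (LINT s:{0..exp (- t)}|lebesgue. g s)"

definition solves_in_distributions ::
  "nat \<Rightarrow> (real \<Rightarrow> real) \<Rightarrow> real \<Rightarrow> (real \<Rightarrow> real) \<Rightarrow> bool" where
  "solves_in_distributions N g lam w \<longleftrightarrow>
     (\<forall>\<phi>. test_function \<phi> \<longrightarrow>
        (LINT t:{0<..}|lebesgue.
           w t * (- deriv (deriv \<phi>) t - (real N - 2) * deriv \<phi> t + (real N - 1) * \<phi> t))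
        = (LINT t:{0<..}|lebesgue. bvp_rhs N g lam w t * \<phi> t))"

(* An element of H1_mu is only determined almost everywhere, so its boundary values are those
   of its (unique) continuous representative on [0, infinity). *)
definition boundary_conditions :: "(real \<Rightarrow> real) \<Rightarrow> bool" where
  "boundary_conditions w \<longleftrightarrow>
     (\<exists>u. continuous_on {0..} u \<and> (AE t in lebesgue_on {0..}. u t = w t) \<and>
          u 0 = 0 \<and> (u \<longlongrightarrow> 0) at_top)"

definition weak_solution ::
  "nat \<Rightarrow> (real \<Rightarrow> real) \<Rightarrow> real \<Rightarrow> (real \<Rightarrow> real) \<Rightarrow> bool" where
  "weak_solution N g lam w \<longleftrightarrow>
     w \<in> H1_mu N \<and> solves_in_distributions N g lam w \<and> boundary_conditions w"

end

theory Submission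
  imports Defs
begin

text \<open>
  The obstruction is local near \<open>t = 0\<close>. Since \<open>\<integral>\<^sub>0\<^sup>1 g > 0\<close>, the forcing term is positive on some
  interval \<open>[a, b]\<close> close to \<open>0\<close>. Test the equation with \<open>\<phi> = \<eta>\<^sup>4\<close>, where \<open>\<eta>\<close> is a bump function
  on \<open>(a, b)\<close>; then the adjoint operator gives \<open>L \<phi> = \<eta>\<^sup>2 K\<close> with \<open>K\<close> continuous. By AM-GM the term
  \<open>w \<eta>\<^sup>2 K\<close> is at most the quadratic term \<open>(N-1)/2 e\<^sup>-\<^sup>t w\<^sup>2 \<phi>\<close> plus \<open>K\<^sup>2 e\<^sup>t / (2(N-1))\<close>, so that
  \<open>\<lambda>\<close> times a fixed positive integral is bounded independently of \<open>w\<close>.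
\<close>

text \<open>With \<open>p = 1\<close> this is the classical smooth function that is flat at 0.
  Allowing every polynomial makes the family closed under differentiation, so smoothness needs only
  one derivative computation.\<close>

definition flat :: "real poly \<Rightarrow> real \<Rightarrow> real" where
  "flat p x = (if x \<le> 0 then 0 else poly p (inverse x) * exp (- inverse x))"

lemma poly_times_exp_neg_tendsto_0: "((\<lambda>y::real. poly p y * exp (- y)) \<longlongrightarrow> 0) at_top"
proof -
  have "((\<lambda>y::real. \<Sum>i\<le>degree p. coeff p i * (y ^ i / exp y)) \<longlongrightarrow> (\<Sum>i\<le>degree p. coeff p i * 0)) at_top"
    by (intro tendsto_intros tendsto_power_div_exp_0)
  moreover have "poly p y * exp (- y) = (\<Sum>i\<le>degree p. coeff p i * (y ^ i / exp y))" for y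
    by (simp add: poly_altdef sum_distrib_right exp_minus divide_inverse mult.assoc)
  ultimately show ?thesis by simp
qed

lemma flat_tendsto_0: "(flat p \<longlongrightarrow> 0) (at 0)"
proof -
  have "((\<lambda>x. poly p (inverse x) * exp (- inverse x)) \<longlongrightarrow> 0) (at_right 0)"
    by (rule filterlim_compose[OF poly_times_exp_neg_tendsto_0 filterlim_inverse_at_top_right])
  then have "(flat p \<longlongrightarrow> 0) (at_right 0)"
    by (rule Lim_transform_eventually)
       (auto simp: flat_def eventually_at intro!: exI[of _ 1])
  moreover have "(flat p \<longlongrightarrow> 0) (at_left 0)"
    by (rule tendsto_eventually)
       (auto simp: flat_def eventually_at intro!: exI[of _ 1])
  ultimately show ?thesis by (simp add: filterlim_split_at)
qed

text \<open>For positive \<open>x\<close> put y = 1/x: then d/dx = -y^2 d/dy, and d/dy sends p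
  e^(-y) to (p' - p) e^(-y). At 0 the difference quotient is \<open>flat\<close> of y p, which tends
  to 0.\<close>

lemma flat_has_derivative:
  "(flat p has_real_derivative flat ([:0, 0, 1:] * (p - pderiv p)) x) (at x)"
proof -
  consider "x < 0" | "x = 0" | "x > 0" by linarith
  then show ?thesis
  proof cases
    case 1
    have "((\<lambda>_. 0) has_real_derivative 0) (at x)" by simp
    then show ?thesis
      using has_field_derivative_transform_within_open[of "\<lambda>_. 0" 0 x "{..<0}" "flat p"] 1
      by (simp add: flat_def)
  next
    case 2
    have "((\<lambda>h. flat p h / h) \<longlongrightarrow> 0) (at 0)"
      by (rule Lim_transform_eventually[OF flat_tendsto_0[of "[:0,1:] * p"]])
         (auto simp: flat_def field_simps eventually_at intro!: exI[of _ 1])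
    with 2 show ?thesis by (simp add: DERIV_def flat_def)
  next
    case 3
    have "((\<lambda>x. poly p (inverse x) * exp (- inverse x)) has_real_derivative
            flat ([:0, 0, 1:] * (p - pderiv p)) x) (at x)"
      using 3 by (auto intro!: derivative_eq_intros DERIV_chain2[OF poly_DERIV]
          simp: flat_def algebra_simps power2_eq_square)
    then show ?thesis
      by (rule has_field_derivative_transform_within_open[where S="{0<..}"]) (use 3 in \<open>auto simp: flat_def\<close>)
  qed
qed

text \<open>Products of the two kinds of generators give bumps on (a, b). By the product rule the
  set is stable under differentiation, so all higher derivatives exist without explicit
  formulas.\<close>

inductive_set bump_algebra :: "real \<Rightarrow> real \<Rightarrow> (real \<Rightarrow> real) set" for a b where
  left: "(\<lambda>t. flat p (t - a)) \<in> bump_algebra a b"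
| right: "(\<lambda>t. flat p (b - t)) \<in> bump_algebra a b"
| add: "f \<in> bump_algebra a b \<Longrightarrow> h \<in> bump_algebra a b \<Longrightarrow> (\<lambda>t. f t + h t) \<in> bump_algebra a b"
| mult: "f \<in> bump_algebra a b \<Longrightarrow> h \<in> bump_algebra a b \<Longrightarrow> (\<lambda>t. f t * h t) \<in> bump_algebra a b"

lemma bump_algebra_derivative:
  "f \<in> bump_algebra a b \<Longrightarrow> \<exists>f'\<in>bump_algebra a b. \<forall>t. (f has_real_derivative f' t) (at t)"
proof (induction rule: bump_algebra.induct)
  case (left p)
  have "((\<lambda>t. flat p (t - a)) has_real_derivative flat ([:0, 0, 1:] * (p - pderiv p)) (t - a)) (at t)" for t
    by (rule DERIV_cong[OF DERIV_chain2[OF flat_has_derivative]])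
       (auto intro!: derivative_eq_intros)
  then show ?case by (intro bexI[OF _ bump_algebra.left] allI)
next
  case (right p)
  \<comment> \<open>The minus sign from the inner derivative of \<open>b - t\<close> is absorbed
    into the polynomial.\<close>
  have "((\<lambda>t. flat p (b - t)) has_real_derivative flat (- ([:0, 0, 1:] * (p - pderiv p))) (b - t)) (at t)" for t
    by (rule DERIV_cong[OF DERIV_chain2[OF flat_has_derivative]])
       (auto intro!: derivative_eq_intros simp: flat_def)
  then show ?case by (intro bexI[OF _ bump_algebra.right] allI)
next
  case (add f h)
  then obtain f' h' where D: "f' \<in> bump_algebra a b" "h' \<in> bump_algebra a b"
    "\<forall>t. (f has_real_derivative f' t) (at t)" "\<forall>t. (h has_real_derivative h' t) (at t)"
    by blast
  then show ?case
    by (intro bexI[of _ "\<lambda>t. f' t + h' t"]) (auto intro!: derivative_intros bump_algebra.add)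
next
  case (mult f h)
  then obtain f' h' where D: "f' \<in> bump_algebra a b" "h' \<in> bump_algebra a b"
    "\<forall>t. (f has_real_derivative f' t) (at t)" "\<forall>t. (h has_real_derivative h' t) (at t)"
    by blast
  with mult show ?case
    by (intro bexI[of _ "\<lambda>t. f' t * h t + h' t * f t"])
       (auto intro!: derivative_eq_intros bump_algebra.add bump_algebra.mult)
qed

lemma bump_algebra_higher_deriv:
  assumes "f \<in> bump_algebra a b"
  shows "(deriv ^^ k) f \<in> bump_algebra a b"
proof (induction k)
  case (Suc k)
  then obtain f' where "f' \<in> bump_algebra a b" "\<forall>t. ((deriv ^^ k) f has_real_derivative f' t) (at t)"
    using bump_algebra_derivative by blast
  moreover from this have "deriv ((deriv ^^ k) f) = f'"
    using DERIV_imp_deriv by blast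
  ultimately show ?case by simp
qed (use assms in simp)

lemma bump_algebra_DERIV:
  assumes "f \<in> bump_algebra a b"
  shows "(f has_real_derivative deriv f t) (at t)"
  using bump_algebra_derivative[OF assms] DERIV_imp_deriv by metis

lemma bump_algebra_continuous_on: "f \<in> bump_algebra a b \<Longrightarrow> continuous_on S f"
  by (meson DERIV_isCont bump_algebra_DERIV continuous_at_imp_continuous_on)

lemma test_functionI_bump_algebra:
  assumes "f \<in> bump_algebra a b" and "{t. f t \<noteq> 0} = {a<..<b}" and "0 < a" "a < b"
  shows "test_function f"
  unfolding test_function_def
  using assms bump_algebra_DERIV[OF bump_algebra_higher_deriv[OF assms(1)]]
  by (auto simp: real_differentiable_def)

text \<open>Used to replace \<open>w\<close> by its continuous representative: \<open>h\<close> is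
  the integrand as it occurs in the equation, \<open>k\<close> its continuous version, and
  \<open>Z\<close> the null set where they may differ. Integrability of \<open>h\<close> is
  inherited from \<open>k\<close>.\<close>

lemma LINT_eq_integral_interval:
  fixes h k :: "real \<Rightarrow> real"
  assumes k: "continuous_on {a..b} k" and S: "{a..b} \<subseteq> S"
    and zero: "\<And>t. t \<in> S \<Longrightarrow> t \<notin> {a..b} \<Longrightarrow> h t = 0"
    and Z: "negligible Z" "\<And>t. t \<in> {a..b} - Z \<Longrightarrow> h t = k t"
  shows "(LINT t:S|lebesgue. h t) = integral {a..b} k"
proof -
  have "(LINT t:S|lebesgue. h t) = (LINT t:{a..b}|lebesgue. h t)"
    unfolding set_lebesgue_integral_def
    by (rule Bochner_Integration.integral_cong) (use S zero in \<open>auto simp: indicator_def\<close>)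
  also have "h absolutely_integrable_on {a..b}"
    by (rule absolutely_integrable_spike[OF absolutely_integrable_continuous_real[OF k] Z])
  then have "(LINT t:{a..b}|lebesgue. h t) = integral {a..b} h"
    by (rule set_lebesgue_integral_eq_integral)
  also have "\<dots> = integral {a..b} k"
    by (rule integral_spike[OF Z(1)]) (use Z(2) in auto)
  finally show ?thesis .
qed

text \<open>A nonnegative function with integral 0 vanishes almost everywhere, which would force the
  essential supremum to be at most 0.\<close>

lemma integral_pos_of_esssup_pos:
  fixes g :: "real \<Rightarrow> real"
  assumes g: "g absolutely_integrable_on {0..1}"
    and nonneg: "AE s in lebesgue_on {0..1}. 0 \<le> g s"
    and pos: "esssup (lebesgue_on {0..1}) (\<lambda>s. ereal (g s)) > 0"
  shows "integral {0..1} g > 0"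
proof -
  have int: "integrable (lebesgue_on {0..1}) g"
    using g by (simp add: integrable_restrict_space set_integrable_def)
  then have meas: "(\<lambda>s. ereal (g s)) \<in> borel_measurable (lebesgue_on {0..1})"
    by (intro borel_measurable_ereal borel_measurable_integrable)
  have eq: "integral {0..1} g = integral\<^sup>L (lebesgue_on {0..1}) g"
    using lebesgue_integral_eq_integral[OF int] by simp
  have "integral\<^sup>L (lebesgue_on {0..1}) g \<noteq> 0"
  proof
    assume "integral\<^sup>L (lebesgue_on {0..1}) g = 0"
    then have "AE s in lebesgue_on {0..1}. g s = 0"
      using integral_nonneg_eq_0_iff_AE[OF int nonneg] by simp
    then have "esssup (lebesgue_on {0..1}) (\<lambda>s. ereal (g s)) \<le> 0"
      by (intro esssup_I[OF meas]) auto
    with pos show False by simp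
  qed
  then show ?thesis
    using integral_nonneg_AE[OF nonneg] eq by simp
qed

theorem theorem6p3:
  fixes N :: nat and g :: "real \<Rightarrow> real"
  assumes "N \<in> {2, 3}"
    and "g absolutely_integrable_on {0..1}"
    and "AE s in lebesgue_on {0..1}. 0 \<le> g s"
    and "esssup (lebesgue_on {0..1}) (\<lambda>s. ereal (g s)) > 0"
  shows "\<exists>lam1>0. \<forall>lam>lam1. \<not> (\<exists>w. weak_solution N g lam w)"
proof -
  define G where "G t = integral {0..exp (- t)} g" for t
  have G_eq: "(LINT s:{0..exp (- t)}|lebesgue. g s) = G t" if "t \<ge> 0" for t
    unfolding G_def
    by (intro set_lebesgue_integral_eq_integral absolutely_integrable_on_subinterval[OF assms(2)])
       (use that in auto)
  have cG: "continuous_on {0..} G"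
    unfolding G_def
    by (rule continuous_on_compose2[OF indefinite_integral_continuous_1[where f=g and a=0 and b=1]])
       (auto intro!: continuous_intros set_lebesgue_integral_eq_integral(1)[OF assms(2)])
  have "G 0 > 0"
    using integral_pos_of_esssup_pos[OF assms(2-4)] by (simp add: G_def)
  moreover have "(G \<longlongrightarrow> G 0) (at 0 within {0..})"
    using cG by (simp add: continuous_on_def)
  ultimately have "\<forall>\<^sub>F t in at 0 within {0..}. G t > 0"
    by (simp add: order_tendstoD)
  then obtain d where d: "d > 0" "\<And>t. 0 < t \<Longrightarrow> t < d \<Longrightarrow> G t > 0"
    by (force simp: eventually_at dist_real_def)
  \<comment> \<open>Any compact interval inside (0, d) would do: the test function must be supported
    away from 0, and \<open>G\<close> is known to be positive only before \<open>d\<close>.\<close>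
  define a b where "a = d / 3" and "b = d / 2"
  have ab: "0 < a" "a < b" and Gpos: "\<And>t. t \<in> {a..b} \<Longrightarrow> G t > 0"
    using d by (auto simp: a_def b_def)

  define \<eta> where "\<eta> t = flat 1 (t - a) * flat 1 (b - t)" for t
  have \<eta>_mem: "\<eta> \<in> bump_algebra a b"
    unfolding \<eta>_def by (intro bump_algebra.intros)
  have \<eta>_supp: "\<eta> t \<noteq> 0 \<longleftrightarrow> a < t \<and> t < b" for t
    by (auto simp: \<eta>_def flat_def)
  \<comment> \<open>Two derivatives remove at most two factors of \<open>\<eta>\<close>, so
    \<open>\<eta>\<close> squared still divides L \<phi>. Hence (L \<phi>)^2 / \<phi> stays bounded
    on the support, as completing the square requires.\<close>
  define \<phi> where "\<phi> t = (\<eta> t * \<eta> t) * (\<eta> t * \<eta> t)" for t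
  have \<phi>_mem: "\<phi> \<in> bump_algebra a b"
    unfolding \<phi>_def by (intro bump_algebra.mult \<eta>_mem)
  have "test_function \<phi>"
    by (rule test_functionI_bump_algebra[OF \<phi>_mem _ ab]) (auto simp: \<phi>_def \<eta>_supp)
  note d1 = bump_algebra_DERIV[OF \<eta>_mem]
  have \<eta>'_mem: "deriv \<eta> \<in> bump_algebra a b"
    using bump_algebra_higher_deriv[OF \<eta>_mem, of 1] by simp
  note d2 = bump_algebra_DERIV[OF \<eta>'_mem]
  have \<eta>''_mem: "deriv (deriv \<eta>) \<in> bump_algebra a b"
    using bump_algebra_higher_deriv[OF \<eta>'_mem, of 1] by simp
  have \<phi>': "deriv \<phi> = (\<lambda>t. 4 * \<eta> t ^ 3 * deriv \<eta> t)"
    unfolding \<phi>_def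
    by (intro ext DERIV_imp_deriv)
       (auto intro!: derivative_eq_intros d1 simp: algebra_simps power3_eq_cube)
  have \<phi>'': "deriv (deriv \<phi>) = (\<lambda>t. 12 * (\<eta> t)\<^sup>2 * (deriv \<eta> t)\<^sup>2 + 4 * \<eta> t ^ 3 * deriv (deriv \<eta>) t)"
    unfolding \<phi>'
    by (intro ext DERIV_imp_deriv)
       ((rule derivative_eq_intros d1 d2 refl)+, simp add: algebra_simps power2_eq_square power3_eq_cube)
  define K where "K t = - (12 * (deriv \<eta> t)\<^sup>2 + 4 * \<eta> t * deriv (deriv \<eta>) t)
      - (real N - 2) * (4 * \<eta> t * deriv \<eta> t) + (real N - 1) * (\<eta> t)\<^sup>2" for t
  have L\<phi>: "- deriv (deriv \<phi>) t - (real N - 2) * deriv \<phi> t + (real N - 1) * \<phi> t = (\<eta> t)\<^sup>2 * K t" for t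
    unfolding \<phi>'' unfolding \<phi>' K_def \<phi>_def by (simp add: algebra_simps power2_eq_square power3_eq_cube)
  note c\<eta> = bump_algebra_continuous_on[OF \<eta>_mem]
    bump_algebra_continuous_on[OF \<eta>'_mem] bump_algebra_continuous_on[OF \<eta>''_mem]
    bump_algebra_continuous_on[OF \<phi>_mem]
  have cK: "continuous_on {a..b} K"
    unfolding K_def by (intro continuous_intros c\<eta>)

  define M where "M = real N - 1"
  have M: "M > 0" using assms(1) by (auto simp: M_def)
  \<comment> \<open>\<open>C\<close> integrates the remainder of the completed square. It depends
    only on \<open>N\<close> and the bump, so it is fixed before \<open>lam\<close> and
    \<open>w\<close>.\<close>
  define C where "C = integral {a..b} (\<lambda>t. (K t)\<^sup>2 * exp t / (2 * M))"
  \<comment> \<open>\<open>F\<close> is the coefficient of \<open>lam\<close> in the tested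
    equation. It vanishes at \<open>a\<close> and \<open>b\<close>, but positivity in the open
    interval and continuity suffice for a positive integral.\<close>
  define F where "F t = exp ((real N - 3) * t) * G t * \<phi> t" for t
  have cG': "continuous_on {a..b} G"
    by (rule continuous_on_subset[OF cG]) (use ab in auto)
  have cF: "continuous_on {a..b} F"
    unfolding F_def by (intro continuous_intros c\<eta> cG')
  have F_pos: "F t > 0" if "t \<in> {a<..<b}" for t
    using that Gpos[of t] \<eta>_supp[of t]
    by (auto simp: F_def \<phi>_def zero_less_mult_iff not_less_iff_gr_or_eq)
  have I_pos: "integral {a..b} F > 0"
    using integral_less_real[of a b "\<lambda>_. 0" F] cF F_pos ab by simp

  show ?thesis
  \<comment> \<open>The tested equation will give \<open>lam * integral {a..b} F \<le> C\<close>.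
    The absolute value and the added 1 make the threshold positive whatever the sign of
    \<open>C\<close>.\<close>
  proof (intro exI[of _ "\<bar>C\<bar> / integral {a..b} F + 1"] conjI allI impI notI)
    show "0 < \<bar>C\<bar> / integral {a..b} F + 1" using I_pos by (simp add: add_nonneg_pos)
  next
    fix lam assume lam: "lam > \<bar>C\<bar> / integral {a..b} F + 1" and "\<exists>w. weak_solution N g lam w"
    then obtain w u where sol: "solves_in_distributions N g lam w"
      and u: "continuous_on {0..} u" "AE t in lebesgue_on {0..}. u t = w t"
      unfolding weak_solution_def boundary_conditions_def by blast
    have "AE t in lebesgue. t \<in> {0..} \<longrightarrow> u t = w t"
      using u(2) by (simp add: AE_restrict_space_iff)
    then obtain Z where "Z \<in> null_sets lebesgue" "{t. \<not> (t \<in> {0..} \<longrightarrow> u t = w t)} \<subseteq> Z"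
      by (auto simp: eventually_ae_filter)
    then have Z: "negligible Z" "\<And>t. t \<ge> 0 \<Longrightarrow> t \<notin> Z \<Longrightarrow> w t = u t"
      by (auto simp: negligible_iff_null_sets)
    have cu: "continuous_on {a..b} u"
      by (rule continuous_on_subset[OF u(1)]) (use ab in auto)
    have \<eta>_0: "\<eta> t = 0" if "t \<notin> {a..b}" for t
      using that \<eta>_supp[of t] by auto
    have lhs: "(LINT t:{0<..}|lebesgue.
           w t * (- deriv (deriv \<phi>) t - (real N - 2) * deriv \<phi> t + (real N - 1) * \<phi> t))
        = integral {a..b} (\<lambda>t. u t * ((\<eta> t)\<^sup>2 * K t))"
      unfolding L\<phi>
      by (rule LINT_eq_integral_interval[where Z=Z])
         (use ab \<eta>_0 Z in \<open>auto intro!: continuous_intros cu c\<eta> cK\<close>)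
    have rhs: "(LINT t:{0<..}|lebesgue. bvp_rhs N g lam w t * \<phi> t)
        = integral {a..b} (\<lambda>t. M / 2 * exp (- t) * (u t)\<^sup>2 * \<phi> t + lam * F t)"
      \<comment> \<open>Here \<open>G_eq\<close> turns the inner Lebesgue integral of
        \<open>g\<close> into the continuous function \<open>G\<close>.\<close>
      by (rule LINT_eq_integral_interval[where Z=Z])
         (use ab \<eta>_0 Z in \<open>auto intro!: continuous_intros cu c\<eta> cF cG'
            simp: \<phi>_def bvp_rhs_def G_eq F_def M_def algebra_simps\<close>)
    have "integral {a..b} (\<lambda>t. M / 2 * exp (- t) * (u t)\<^sup>2 * \<phi> t + lam * F t)
        = integral {a..b} (\<lambda>t. u t * ((\<eta> t)\<^sup>2 * K t))"
      using sol \<open>test_function \<phi>\<close> lhs rhs by (simp add: solves_in_distributions_def)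
    also have "\<dots> \<le> integral {a..b} (\<lambda>t. M / 2 * exp (- t) * (u t)\<^sup>2 * \<phi> t + (K t)\<^sup>2 * exp t / (2 * M))"
    proof (rule integral_le)
      fix t
      \<comment> \<open>The factor \<open>exp t / (2 * M)\<close> is chosen so that the cross term
        of the expanded square is exactly the left integrand and the first square is the quadratic
        term of the equation.\<close>
      have "0 \<le> (M * exp (- t) * u t * (\<eta> t)\<^sup>2 - K t)\<^sup>2 * exp t / (2 * M)"
        using M by simp
      also have "\<dots> = M / 2 * exp (- t) * (u t)\<^sup>2 * \<phi> t + (K t)\<^sup>2 * exp t / (2 * M) - u t * ((\<eta> t)\<^sup>2 * K t)"
        using M by (simp add: \<phi>_def power2_eq_square exp_minus field_simps)
      finally show "u t * ((\<eta> t)\<^sup>2 * K t) \<le> M / 2 * exp (- t) * (u t)\<^sup>2 * \<phi> t + (K t)\<^sup>2 * exp t / (2 * M)"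
        by simp
    qed (use M in \<open>auto intro!: integrable_continuous_real continuous_intros cu c\<eta> cK\<close>)
    also have "\<dots> = integral {a..b} (\<lambda>t. M / 2 * exp (- t) * (u t)\<^sup>2 * \<phi> t) + C"
      unfolding C_def using M
      by (intro Henstock_Kurzweil_Integration.integral_add)
         (auto intro!: integrable_continuous_real continuous_intros cu c\<eta> cK)
    \<comment> \<open>The integral of the quadratic term stands on both sides and cancels, which
      removes all dependence on the solution.\<close>
    finally have "lam * integral {a..b} F \<le> C"
      by (subst (asm) Henstock_Kurzweil_Integration.integral_add)
         (auto intro!: integrable_continuous_real continuous_intros cu c\<eta> cF)
    moreover have "\<bar>C\<bar> < lam * integral {a..b} F"
      using lam I_pos by (simp add: field_simps)
    ultimately show False by simp
  qed
qed

end
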